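(* Consider the BilateralMatch(H) policy $\mathcal{B}_H$ and fix $\lambda_E>0$ and $p_E\in(0,1]$. The limiting average waiting time $\lim_{p_H\to0}p_H\,w_H^{\mathcal{B}_H}$ of $H$ agents, as a function of $\lambda_H$, increases with $\lambda_H$ in the interval $0<\lambda_H<\lambda_E$.
   Context: Model: agents of two types $H$ (hard-to-match) and $E$ (easy-to-match) arrive to a market according to independent Poisson processes with rates $\lambda_H,\lambda_E>0$. Each agent owns an item; an agent of type $T\in\{H,E\}$ finds the item of any other agent compatible with probability $p_T$, independently over all ordered pairs. Here $p_E\in(0,1]$ is a fixed constant and $p_H\in(0,1)$ is a parameter tending to $0$. Two agents can form a bilateral exchange (2-cycle) if each finds the other's item compatible. Policy BilateralMatch(H) ($\mathcal{B}_H$): upon arrival of a new agent, if a 2-cycle can be formed between it and a waiting agent, one such cycle is executed and both agents leave; if there are several such cycles, priority is given to cycles whose waiting agent is of type $H$, further ties being broken uniformly at random. Otherwise the new agent joins the market and waits. The numbers $[H_t,E_t]\in\mathbb{N}^2$ of waiting $H$ and $E$ agents form a positive recurrent continuous-time Markov chain with transition rates (convention $0^0=1$) $Q([h,e],[h+1,e])=\lambda_H(1-p_H^2)^h(1-p_Ep_H)^e$, $Q([h,e],[h-1,e])=\lambda_H(1-(1-p_H^2)^h)+\lambda_E(1-(1-p_Ep_H)^h)$, $Q([h,e],[h,e+1])=\lambda_E(1-p_Ep_H)^h(1-p_E^2)^e$, $Q([h,e],[h,e-1])=\lambda_H(1-p_H^2)^h(1-(1-p_Ep_H)^e)+\lambda_E(1-p_Ep_H)^h(1-(1-p_E^2)^e)$.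 $[H^{\mathcal{B}_H},E^{\mathcal{B}_H}]$ has the stationary distribution, and the steady-state average waiting time of $H$ agents is $w_H^{\mathcal{B}_H}=\mathbb{E}[H^{\mathcal{B}_H}]/\lambda_H$ (Little's law). For $\lambda_H<\lambda_E$ the waiting time scales as $1/p_H$, and "limiting average waiting time" means $\lim_{p_H\to0}p_H\,w_H^{\mathcal{B}_H}$. *)

theory Defs
  imports "HOL-Probability.Probability"
begin

text \<open>Transition rates between distinct states \<open>(h, e)\<close>; the diagonal value is 0.
  A decrease is matched as \<open>h = Suc h'\<close>, so no rate leads out of \<open>\<nat>\<^sup>2\<close>.
  For \<open>p\<^sub>E = 1\<close> and \<open>e = 0\<close> the power \<open>(1 - p\<^sub>E\<^sup>2) ^ e\<close> is \<open>0 ^ 0 = 1\<close>.\<close>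

definition BH_rate ::
  "real \<Rightarrow> real \<Rightarrow> real \<Rightarrow> real \<Rightarrow> nat \<times> nat \<Rightarrow> nat \<times> nat \<Rightarrow> real" where
  "BH_rate lam\<^sub>H lam\<^sub>E p\<^sub>H p\<^sub>E = (\<lambda>(h, e) (h', e').
     if h' = Suc h \<and> e' = e then
       lam\<^sub>H * (1 - p\<^sub>H^2)^h * (1 - p\<^sub>E * p\<^sub>H)^e
     else if h = Suc h' \<and> e' = e then
       lam\<^sub>H * (1 - (1 - p\<^sub>H^2)^h) + lam\<^sub>E * (1 - (1 - p\<^sub>E * p\<^sub>H)^h)
     else if h' = h \<and> e' = Suc e then
       lam\<^sub>E * (1 - p\<^sub>E * p\<^sub>H)^h * (1 - p\<^sub>E^2)^e
     else if h' = h \<and> e = Suc e' then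
       lam\<^sub>H * (1 - p\<^sub>H^2)^h * (1 - (1 - p\<^sub>E * p\<^sub>H)^e)
       + lam\<^sub>E * (1 - p\<^sub>E * p\<^sub>H)^h * (1 - (1 - p\<^sub>E^2)^e)
     else 0)"

text \<open>Global balance. For bounded rates, such as the ones above (total exit rate at most
  \<open>lam\<^sub>H + lam\<^sub>E\<close>), the chain is non-explosive and this is equivalent to invariance under its
  transition semigroup. Every state above has at most four neighbours, so both infinite
  sums then have only finitely many nonzero terms.\<close>

definition stationary_distribution :: "('s \<Rightarrow> 's \<Rightarrow> real) \<Rightarrow> 's pmf \<Rightarrow> bool" where
  "stationary_distribution Q \<pi> \<longleftrightarrow>
     (\<forall>y. (\<Sum>\<^sub>\<infinity>x\<in>-{y}. pmf \<pi> x * Q x y) = pmf \<pi> y * (\<Sum>\<^sub>\<infinity>x\<in>-{y}. Q y x))"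

definition BH_stationary :: "real \<Rightarrow> real \<Rightarrow> real \<Rightarrow> real \<Rightarrow> (nat \<times> nat) pmf" where
  "BH_stationary lam\<^sub>H lam\<^sub>E p\<^sub>H p\<^sub>E =
     (THE \<pi>. stationary_distribution (BH_rate lam\<^sub>H lam\<^sub>E p\<^sub>H p\<^sub>E) \<pi>)"

text \<open>Average waiting time of \<open>H\<close> agents by Little's law. It is extended-valued, so an
  infinite mean queue length would show up as \<open>\<infinity>\<close> and not as a default value.\<close>

definition BH_wait_H :: "real \<Rightarrow> real \<Rightarrow> real \<Rightarrow> real \<Rightarrow> ennreal" where
  "BH_wait_H lam\<^sub>H lam\<^sub>E p\<^sub>H p\<^sub>E =
     (\<integral>\<^sup>+(h, e). of_nat h \<partial>measure_pmf (BH_stationary lam\<^sub>H lam\<^sub>E p\<^sub>H p\<^sub>E)) / ennreal lam\<^sub>H"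

end

theory Submission imports Defs begin

text \<open>
  The total exit rate of every state is exactly \<open>lam\<^sub>H + lam\<^sub>E\<close>, so the stationary distributions are the
  invariant distributions of the embedded jump kernel. There is at most one, as \<open>(0, 0)\<close> can be
  reached from every state; existence with a moment bound comes from a Lyapunov function, Cesaro
  averages and tightness.

  Put \<open>q = 1 - p\<^sub>E p\<^sub>H\<close> and \<open>\<beta> = - ln q\<close>. The drift of \<open>h\<close> is essentially \<open>lam\<^sub>H - lam\<^sub>E (1 - q ^ h)\<close>, which
  vanishes at \<open>h\<^sub>0 = x / \<beta>\<close>, \<open>x = - ln (1 - lam\<^sub>H / lam\<^sub>E)\<close>. The Lyapunov function
  \<open>(h - h\<^sub>0)\<^sup>2 / 2 + \<kappa> e\<^sup>2 / 2\<close> bounds the stationary mean of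
  \<open>(h - h\<^sub>0) (1 - exp (- \<beta> (h - h\<^sub>0)))\<close> uniformly in \<open>p\<^sub>H\<close>, hence the mean of \<open>\<bar>\<beta> h - x\<bar>\<close> is
  \<open>O(sqrt \<beta>)\<close>. As \<open>\<beta> / p\<^sub>H\<close> tends to \<open>p\<^sub>E\<close>, the limiting waiting time is
  \<open>- ln (1 - lam\<^sub>H / lam\<^sub>E) / (p\<^sub>E lam\<^sub>H)\<close>, and \<open>- ln (1 - u) / u\<close> is strictly increasing.
\<close>

section \<open>Invariant distributions of discrete kernels\<close>

lemma pmf_eqI_le:
  assumes "\<And>x. pmf p x \<le> pmf q x"
  shows "p = q"
  using assms pmf_neq_exists_less[of q p] by (metis linorder_not_less)

lemma pmf_bind_count_space:
  "ennreal (pmf (bind_pmf p K) y) = (\<integral>\<^sup>+x. ennreal (pmf p x) * ennreal (pmf (K x) y) \<partial>count_space UNIV)"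
  by (simp add: ennreal_pmf_bind nn_integral_measure_pmf)

text \<open>The pointwise minimum \<open>m\<close> of two invariant distributions is subinvariant.
  The kernel preserves its finite total mass, so \<open>m\<close> is in fact invariant. By
  subtraction the excess \<open>a = p - m\<close> is invariant as well, and an invariant nonnegative
  function that is positive at \<open>x\<close> is positive at every successor of
  \<open>x\<close>.\<close>

lemma pmf_invariant_diff_spreads:
  fixes K :: "'s \<Rightarrow> 's pmf"
  assumes p: "bind_pmf p K = p" and q: "bind_pmf q K = q"
    and x: "pmf q x < pmf p x" and y: "y \<in> set_pmf (K x)"
  shows "pmf q y < pmf p y"
proof -
  define m where "m z = min (pmf p z) (pmf q z)" for z
  define a where "a z = pmf p z - m z" for z
  define T where "T f z = (\<integral>\<^sup>+x. ennreal (f x) * ennreal (pmf (K x) z) \<partial>count_space UNIV)"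
    for f :: "'s \<Rightarrow> real" and z
  have m0: "0 \<le> m z" for z by (simp add: m_def)
  have a0: "0 \<le> a z" for z by (simp add: m_def a_def)
  have Tp: "T (pmf p) z = pmf p z" and Tq: "T (pmf q) z = pmf q z" for z
    using pmf_bind_count_space[of p K z] pmf_bind_count_space[of q K z] p q by (simp_all add: T_def)
  have Tm: "T m z \<le> m z" for z
  proof -
    have "T m z \<le> T (pmf p) z" "T m z \<le> T (pmf q) z"
      unfolding T_def by (intro nn_integral_mono mult_right_mono ennreal_leI; simp add: m_def)+
    then show ?thesis unfolding Tp Tq m_def by (simp add: ennreal_leI min_def)
  qed
  have "(\<integral>\<^sup>+z. T m z \<partial>count_space UNIV) =
     (\<integral>\<^sup>+x. (\<integral>\<^sup>+z. ennreal (m x) * ennreal (pmf (K x) z) \<partial>count_space UNIV) \<partial>count_space UNIV)"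
    unfolding T_def
    using nn_integral_fst_count_space[of "\<lambda>(x, z). ennreal (m x) * ennreal (pmf (K x) z)"]
      nn_integral_snd_count_space[of "\<lambda>(x, z). ennreal (m x) * ennreal (pmf (K x) z)"]
    by simp
  also have "\<dots> = (\<integral>\<^sup>+x. ennreal (m x) \<partial>count_space UNIV)"
    by (simp add: nn_integral_cmult nn_integral_pmf)
  finally have mass: "(\<integral>\<^sup>+z. T m z \<partial>count_space UNIV) = (\<integral>\<^sup>+z. ennreal (m z) \<partial>count_space UNIV)" .
  have "(\<integral>\<^sup>+z. ennreal (m z) \<partial>count_space UNIV) \<le> (\<integral>\<^sup>+z. ennreal (pmf p z) \<partial>count_space UNIV)"
    by (intro nn_integral_mono ennreal_leI) (simp add: m_def)
  also have "\<dots> = 1" by (simp add: nn_integral_pmf)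
  finally have fin: "(\<integral>\<^sup>+z. ennreal (m z) \<partial>count_space UNIV) \<noteq> \<infinity>"
    by (metis ennreal_one_neq_top infinity_ennreal_def top.extremum_unique)
  \<comment> \<open>A nonnegative defect with integral 0 vanishes at every point, because the
    reference measure is counting measure.\<close>
  have "(\<integral>\<^sup>+z. ennreal (m z) - T m z \<partial>count_space UNIV) = 0"
    using Tm mass fin by (subst nn_integral_diff) auto
  then have "ennreal (m z) - T m z = 0" for z
    by (simp add: nn_integral_0_iff_AE AE_count_space)
  then have Tm_eq: "T m z = m z" for z
    using Tm[of z] by (metis diff_eq_0_iff_ennreal order_antisym_conv ennreal_less_top order_le_less)
  have "T (pmf p) z = T m z + T a z" for z
    unfolding T_def
    by (subst nn_integral_add[symmetric])
       (auto intro!: nn_integral_cong simp: a_def ennreal_plus[symmetric] distrib_right[symmetric] m0 m_def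
             simp del: ennreal_plus)
  then have "ennreal (pmf p z) = ennreal (m z) + T a z" for z by (simp add: Tm_eq Tp)
  then have "ennreal (m z) + ennreal (a z) = ennreal (m z) + T a z" for z
    by (simp add: ennreal_plus[symmetric] m0 a0 del: ennreal_plus) (simp add: a_def)
  then have Ta: "ennreal (a z) = T a z" for z
    by (simp add: ennreal_add_left_cancel)
  have "0 < a x * pmf (K x) y"
    using x y by (simp add: a_def m_def pmf_positive)
  then have "0 < ennreal (a x) * ennreal (pmf (K x) y)"
    using a0[of x] by (simp add: ennreal_mult[symmetric])
  also have "\<dots> \<le> T a y"
    unfolding T_def by (rule nn_integral_ge_point) simp
  finally have "0 < ennreal (a y)" by (simp add: Ta)
  then show ?thesis by (simp add: a_def m_def min_def split: if_splits)
qed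

text \<open>Distinct distributions of equal mass exceed each other somewhere. Both excesses
  propagate along the paths to the common state \<open>z\<close>, where they contradict each
  other.\<close>

lemma pmf_invariant_unique:
  fixes K :: "'s \<Rightarrow> 's pmf"
  assumes p: "bind_pmf p K = p" and q: "bind_pmf q K = q"
    and reach: "\<And>x. (x, z) \<in> {(x, y). y \<in> set_pmf (K x)}\<^sup>*"
  shows "p = q"
proof (rule ccontr)
  have less: "pmf q z < pmf p z"
    if p: "bind_pmf p K = p" and q: "bind_pmf q K = q" and "q \<noteq> p" for p q
  proof -
    obtain x where "pmf q x < pmf p x" using pmf_neq_exists_less[OF \<open>q \<noteq> p\<close>] by blast
    with reach[of x] show ?thesis
      by (induction rule: converse_rtrancl_induct) (auto dest: pmf_invariant_diff_spreads[OF p q])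
  qed
  assume "p \<noteq> q"
  with less[OF p q] less[OF q p] show False by simp
qed

section \<open>Limits of probability mass functions and existence\<close>

lemma nn_integral_pmf_Fatou:
  assumes "\<And>x. (\<lambda>n. pmf (M n) x) \<longlonglongrightarrow> pmf p x"
  shows "(\<integral>\<^sup>+x. f x \<partial>measure_pmf p) \<le> liminf (\<lambda>n. \<integral>\<^sup>+x. f x \<partial>measure_pmf (M n))"
proof -
  have "ennreal (pmf p x) * f x \<le> liminf (\<lambda>n. ennreal (pmf (M n) x) * f x)" for x
  \<comment> \<open>Since \<open>f x\<close> may be infinite, the product need not be continuous
    where the limit mass is 0; there the left-hand side is 0 anyway.\<close>
  proof (cases "pmf p x = 0")
    case False
    have "(\<lambda>n. f x * ennreal (pmf (M n) x)) \<longlonglongrightarrow> f x * ennreal (pmf p x)"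
      using False assms by (intro tendsto_mult_ennreal tendsto_const tendsto_ennrealI) auto
    then show ?thesis
      by (simp add: lim_imp_Liminf mult.commute)
  qed simp
  then have "(\<integral>\<^sup>+x. f x \<partial>measure_pmf p) \<le>
      (\<integral>\<^sup>+x. liminf (\<lambda>n. ennreal (pmf (M n) x) * f x) \<partial>count_space UNIV)"
    unfolding nn_integral_measure_pmf by (intro nn_integral_mono)
  also have "\<dots> \<le> liminf (\<lambda>n. \<integral>\<^sup>+x. ennreal (pmf (M n) x) * f x \<partial>count_space UNIV)"
    by (rule nn_integral_liminf) simp
  finally show ?thesis by (simp add: nn_integral_measure_pmf)
qed

text \<open>By Tychonoff the mass functions lie in a compact product of unit intervals; countability
  of the index set makes it sequentially compact. The bound on \<open>G\<close> prevents mass from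
  escaping to infinity, so the pointwise limit is again a probability mass function.\<close>

lemma pmf_tight_subsequence:
  fixes M :: "nat \<Rightarrow> 's::countable pmf" and G :: "'s \<Rightarrow> ennreal"
  assumes bound: "\<And>n. (\<integral>\<^sup>+x. G x \<partial>measure_pmf (M n)) \<le> B" and B: "B < \<infinity>"
    and sublevel: "\<And>m::nat. finite {x. G x \<le> of_nat m}"
  obtains p r where "strict_mono (r :: nat \<Rightarrow> nat)" "\<And>x. (\<lambda>n. pmf (M (r n)) x) \<longlonglongrightarrow> pmf p x"
proof -
  have "compactin (product_topology (\<lambda>_::'s. euclidean :: real topology) UNIV) (PiE UNIV (\<lambda>_. {0..1}))"
    by (subst compactin_PiE) (simp add: compactin_euclidean_iff)
  then have "compact (PiE UNIV (\<lambda>_::'s. {0..1::real}))"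
    by (simp add: euclidean_product_topology compactin_euclidean_iff)
  then have "seq_compact (PiE UNIV (\<lambda>_::'s. {0..1::real}))"
    by (rule compact_imp_seq_compact)
  moreover have "\<forall>n. pmf (M n) \<in> PiE UNIV (\<lambda>_. {0..1})"
    by (auto simp: PiE_def pmf_le_1)
  ultimately obtain l r where l: "l \<in> PiE UNIV (\<lambda>_. {0..1})" and r: "strict_mono (r :: nat \<Rightarrow> nat)"
    and lim: "((\<lambda>n. pmf (M n)) \<circ> r) \<longlonglongrightarrow> l"
    by (rule seq_compactE)
  have lim': "(\<lambda>n. pmf (M (r n)) x) \<longlonglongrightarrow> l x" for x
  proof -
    have "isCont (\<lambda>f::'s \<Rightarrow> real. f x) l"
      using continuous_on_product_coordinates[where i = x, where 'b = real]
      by (metis UNIV_I continuous_on_eq_continuous_at open_UNIV)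
    from isCont_tendsto_compose[OF this lim] show ?thesis by simp
  qed
  have l0: "0 \<le> l x" for x using l by (auto simp: PiE_def)
  have le: "(\<integral>\<^sup>+x. ennreal (l x) \<partial>count_space UNIV) \<le> 1"
  proof -
    have "(\<integral>\<^sup>+x. ennreal (l x) \<partial>count_space UNIV) =
        (\<integral>\<^sup>+x. liminf (\<lambda>n. ennreal (pmf (M (r n)) x)) \<partial>count_space UNIV)"
      by (intro nn_integral_cong lim_imp_Liminf[symmetric] tendsto_ennrealI lim') simp
    also have "\<dots> \<le> liminf (\<lambda>n. \<integral>\<^sup>+x. ennreal (pmf (M (r n)) x) \<partial>count_space UNIV)"
      by (rule nn_integral_liminf) simp
    also have "\<dots> = 1" by (simp add: nn_integral_pmf Liminf_const)
    finally show ?thesis .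
  qed
  obtain b where b: "B = ennreal b" "0 \<le> b" using B by (cases B) auto
  \<comment> \<open>Markov's inequality for \<open>G\<close>: at most \<open>b / Suc m\<close> of
    the mass lies outside a finite sublevel set, uniformly in \<open>n\<close>, and a finite sum
    passes to the limit.\<close>
  have ge: "1 - b / Suc m \<le> sum l {x. G x \<le> of_nat (Suc m)}" for m
  proof -
    let ?F = "{x. G x \<le> of_nat (Suc m)}"
    have fin: "finite ?F" by (rule sublevel)
    have "1 - b / Suc m \<le> sum (pmf (M n)) ?F" for n
    proof -
      have "of_nat (Suc m) * emeasure (M n) (- ?F) = (\<integral>\<^sup>+x. of_nat (Suc m) * indicator (- ?F) x \<partial>M n)"
        by (simp add: nn_integral_cmult_indicator)
      also have "\<dots> \<le> (\<integral>\<^sup>+x. G x \<partial>M n)"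
        by (intro nn_integral_mono) (auto simp: indicator_def)
      also have "\<dots> \<le> ennreal b" using bound b by simp
      finally have "ennreal (real (Suc m) * measure_pmf.prob (M n) (- ?F)) \<le> ennreal b"
        by (simp add: measure_pmf.emeasure_eq_measure ennreal_mult ennreal_of_nat_eq_real_of_nat del: of_nat_Suc)
      then have "real (Suc m) * measure_pmf.prob (M n) (- ?F) \<le> b"
        using b by (simp del: of_nat_Suc)
      then have "measure_pmf.prob (M n) (- ?F) \<le> b / Suc m"
        by (simp add: field_simps)
      moreover have "measure_pmf.prob (M n) (- ?F) = 1 - measure_pmf.prob (M n) ?F"
        using measure_pmf.prob_compl[of ?F "M n"] by (simp add: Compl_eq_Diff_UNIV)
      ultimately show ?thesis using fin by (simp add: measure_measure_pmf_finite)
    qed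
    moreover have "(\<lambda>n. sum (pmf (M (r n))) ?F) \<longlonglongrightarrow> sum l ?F"
      by (intro tendsto_sum lim')
    ultimately show ?thesis
      by (meson LIMSEQ_le_const)
  qed
  have "ennreal (1 - b / Suc m) \<le> (\<integral>\<^sup>+x. ennreal (l x) \<partial>count_space UNIV)" for m
  proof -
    let ?F = "{x. G x \<le> of_nat (Suc m)}"
    have "ennreal (1 - b / Suc m) \<le> ennreal (sum l ?F)" by (rule ennreal_leI[OF ge])
    also have "\<dots> = (\<integral>\<^sup>+x. ennreal (l x) \<partial>count_space ?F)"
      by (simp only: nn_integral_count_space_finite[OF sublevel] sum_ennreal[OF l0])
    also have "\<dots> \<le> (\<integral>\<^sup>+x. ennreal (l x) \<partial>count_space UNIV)"
      by (subst nn_integral_count_space_indicator)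
         (auto intro!: nn_integral_mono simp: indicator_def)
    finally show ?thesis .
  qed
  moreover have "(\<lambda>m. ennreal (1 - b / Suc m)) \<longlonglongrightarrow> ennreal (1 - 0)"
    by (intro tendsto_ennrealI tendsto_diff tendsto_const LIMSEQ_Suc[OF lim_const_over_n])
  ultimately have "1 \<le> (\<integral>\<^sup>+x. ennreal (l x) \<partial>count_space UNIV)"
    by (intro LIMSEQ_le_const2) auto
  with le have "(\<integral>\<^sup>+x. ennreal (l x) \<partial>count_space UNIV) = 1" by (rule antisym)
  then have "pmf (embed_pmf l) x = l x" for x
    using l0 by (subst pmf_embed_pmf) auto
  with lim' r that[of r "embed_pmf l"] show thesis by simp
qed

text \<open>Krylov-Bogoliubov with a Foster-Lyapunov drift: summing the drift inequality along the
  chain started in \<open>x0\<close> bounds the time averages of \<open>G\<close>, so these averages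
  are tight, and any limit point is invariant.\<close>

theorem pmf_invariant_exists:
  fixes K :: "'s::countable \<Rightarrow> 's pmf" and V G :: "'s \<Rightarrow> ennreal"
  assumes drift: "\<And>x. (\<integral>\<^sup>+y. V y \<partial>measure_pmf (K x)) + G x \<le> V x + C" and C: "C < \<infinity>"
    and x0: "V x0 < \<infinity>"
    and sublevel: "\<And>m::nat. finite {x. G x \<le> of_nat m}"
  obtains p where "bind_pmf p K = p" "(\<integral>\<^sup>+x. G x \<partial>measure_pmf p) \<le> C"
proof -
  define X where "X k = ((\<lambda>\<mu>. bind_pmf \<mu> K) ^^ k) (return_pmf x0)" for k
  have X_Suc: "bind_pmf (X k) K = X (Suc k)" for k by (simp add: X_def)
  \<comment> \<open>\<open>M n\<close> is the law of the chain at a uniformly chosen time in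
    \<open>{..n}\<close>, that is, the Cesaro average of the first \<open>Suc n\<close>
    laws.\<close>
  define M where "M n = bind_pmf (pmf_of_set {..n}) X" for n
  have sum: "(\<integral>\<^sup>+x. V x \<partial>X n) + (\<Sum>k<n. \<integral>\<^sup>+x. G x \<partial>X k) \<le> V x0 + of_nat n * C" for n
  proof (induction n)
    case 0
    then show ?case by (simp add: X_def)
  next
    case (Suc n)
    have "(\<integral>\<^sup>+x. V x \<partial>X (Suc n)) + (\<integral>\<^sup>+x. G x \<partial>X n) = (\<integral>\<^sup>+x. (\<integral>\<^sup>+y. V y \<partial>K x) + G x \<partial>X n)"
      by (simp add: X_Suc[symmetric] nn_integral_add)
    also have "\<dots> \<le> (\<integral>\<^sup>+x. V x + C \<partial>X n)" by (intro nn_integral_mono drift)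
    also have "\<dots> = (\<integral>\<^sup>+x. V x \<partial>X n) + C" by (simp add: nn_integral_add)
    finally have step: "(\<integral>\<^sup>+x. V x \<partial>X (Suc n)) + (\<integral>\<^sup>+x. G x \<partial>X n) \<le> (\<integral>\<^sup>+x. V x \<partial>X n) + C" .
    have "(\<integral>\<^sup>+x. V x \<partial>X (Suc n)) + (\<Sum>k<Suc n. \<integral>\<^sup>+x. G x \<partial>X k)
        \<le> ((\<integral>\<^sup>+x. V x \<partial>X n) + C) + (\<Sum>k<n. \<integral>\<^sup>+x. G x \<partial>X k)"
      using add_right_mono[OF step, of "\<Sum>k<n. \<integral>\<^sup>+x. G x \<partial>X k"] by (simp add: ac_simps)
    also have "\<dots> \<le> V x0 + of_nat n * C + C"
      using add_right_mono[OF Suc, of C] by (simp add: ac_simps)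
    finally show ?case by (simp add: distrib_left distrib_right ac_simps)
  qed
  have avg: "(\<integral>\<^sup>+x. G x \<partial>M n) \<le> V x0 / of_nat (Suc n) + C" for n
  proof -
    have "(\<integral>\<^sup>+x. G x \<partial>M n) = (\<Sum>k<Suc n. \<integral>\<^sup>+x. G x \<partial>X k) / of_nat (Suc n)"
      by (simp add: M_def nn_integral_pmf_of_set lessThan_Suc_atMost del: sum.lessThan_Suc)
    also have "\<dots> \<le> (V x0 + of_nat (Suc n) * C) / of_nat (Suc n)"
    proof (rule divide_right_mono_ennreal)
      have "(\<Sum>k<Suc n. \<integral>\<^sup>+x. G x \<partial>X k) \<le> (\<integral>\<^sup>+x. V x \<partial>X (Suc n)) + (\<Sum>k<Suc n. \<integral>\<^sup>+x. G x \<partial>X k)"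
        by simp
      with sum[of "Suc n"] show "(\<Sum>k<Suc n. \<integral>\<^sup>+x. G x \<partial>X k) \<le> V x0 + of_nat (Suc n) * C"
        by (rule order_trans[rotated])
    qed
    also have "\<dots> = V x0 / of_nat (Suc n) + C"
      using ennreal_mult_divide_eq[of "of_nat (Suc n)" C]
      by (simp add: add_divide_distrib_ennreal mult.commute del: of_nat_Suc)
    finally show ?thesis .
  qed
  obtain v where v: "V x0 = ennreal v" "0 \<le> v" using x0 by (cases "V x0") auto
  \<comment> \<open>This cruder bound does not depend on \<open>n\<close> and yields tightness; the
    sharper \<open>avg\<close> is kept for the limit, where the contribution of \<open>V x0\<close>
    disappears.\<close>
  have "(\<integral>\<^sup>+x. G x \<partial>M n) \<le> V x0 + C" for n
  proof -
    have "v * 1 \<le> v * real (Suc n)" using v by (intro mult_left_mono) auto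
    then have "v / Suc n \<le> v" by (simp add: divide_le_eq del: of_nat_Suc)
    then have "V x0 / of_nat (Suc n) \<le> V x0"
      using v by (simp add: divide_ennreal ennreal_of_nat_eq_real_of_nat ennreal_leI del: of_nat_Suc)
    with avg[of n] show ?thesis by (meson add_right_mono order_trans)
  qed
  moreover have "V x0 + C < \<infinity>" using x0 C by simp
  ultimately obtain p r where r: "strict_mono (r :: nat \<Rightarrow> nat)"
    and lim: "\<And>x. (\<lambda>n. pmf (M (r n)) x) \<longlonglongrightarrow> pmf p x"
    using pmf_tight_subsequence[of M G "V x0 + C"] sublevel by metis
  have r_inf: "filterlim r at_top sequentially" by (rule filterlim_subseq[OF r])
  have "(\<integral>\<^sup>+x. G x \<partial>p) \<le> liminf (\<lambda>n. \<integral>\<^sup>+x. G x \<partial>M (r n))"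
    by (rule nn_integral_pmf_Fatou[OF lim])
  also have "\<dots> \<le> liminf (\<lambda>n. V x0 / of_nat (Suc (r n)) + C)"
    by (intro Liminf_mono always_eventually allI avg)
  also have "\<dots> = C"
  proof (rule lim_imp_Liminf)
    have "(\<lambda>n. ennreal (v / Suc n) + C) \<longlonglongrightarrow> ennreal 0 + C"
      by (intro tendsto_intros tendsto_ennrealI LIMSEQ_Suc[OF lim_const_over_n])
    from filterlim_compose[OF this r_inf]
    show "(\<lambda>n. V x0 / of_nat (Suc (r n)) + C) \<longlonglongrightarrow> C"
      using v by (simp add: divide_ennreal ennreal_of_nat_eq_real_of_nat del: of_nat_Suc)
  qed simp
  finally have G: "(\<integral>\<^sup>+x. G x \<partial>p) \<le> C" .
  have avg_pmf: "pmf (M n) y = (\<Sum>k<Suc n. pmf (X k) y) / Suc n" for n y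
    by (simp add: M_def pmf_bind integral_pmf_of_set lessThan_Suc_atMost del: sum.lessThan_Suc)
  have "pmf (bind_pmf (M n) K) y = (\<Sum>k<Suc n. pmf (X (Suc k)) y) / Suc n" for n y
  proof -
    have "bind_pmf (M n) K = bind_pmf (pmf_of_set {..n}) (\<lambda>k. X (Suc k))"
      by (simp add: M_def bind_assoc_pmf X_Suc)
    then show ?thesis
      by (simp add: pmf_bind integral_pmf_of_set lessThan_Suc_atMost del: sum.lessThan_Suc)
  qed
  \<comment> \<open>One application of \<open>K\<close> shifts the average by one time step, so all
    but the two boundary terms cancel.\<close>
  then have eq: "pmf (bind_pmf (M n) K) y - pmf (M n) y = (pmf (X (Suc n)) y - pmf (X 0) y) / Suc n" for n y
    by (simp add: avg_pmf sum_subtractf[symmetric] diff_divide_distrib[symmetric]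
          sum_lessThan_telescope[of "\<lambda>k. pmf (X k) y" "Suc n"] del: sum.lessThan_Suc)
  have diff: "pmf (bind_pmf (M n) K) y \<le> pmf (M n) y + 1 / Suc n" for n y
  proof -
    have "(pmf (X (Suc n)) y - pmf (X 0) y) / Suc n \<le> 1 / Suc n"
      using pmf_le_1[of "X (Suc n)" y] pmf_nonneg[of "X 0" y] by (intro divide_right_mono) linarith+
    then show ?thesis using eq[of n y] by linarith
  qed
  \<comment> \<open>Fatou gives only this inequality; equality of the total masses then turns it
    into invariance.\<close>
  have "pmf (bind_pmf p K) y \<le> pmf p y" for y
  proof -
    have "ennreal (pmf (bind_pmf p K) y) = (\<integral>\<^sup>+x. pmf (K x) y \<partial>p)"
      by (rule ennreal_pmf_bind)
    also have "\<dots> \<le> liminf (\<lambda>n. \<integral>\<^sup>+x. pmf (K x) y \<partial>M (r n))"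
      by (rule nn_integral_pmf_Fatou[OF lim])
    also have "\<dots> \<le> liminf (\<lambda>n. ennreal (pmf (M (r n)) y + 1 / Suc (r n)))"
      by (intro Liminf_mono always_eventually allI) (simp only: ennreal_pmf_bind[symmetric] ennreal_leI diff)
    also have "\<dots> = ennreal (pmf p y + 0)"
      by (intro lim_imp_Liminf tendsto_ennrealI tendsto_add lim
            filterlim_compose[OF LIMSEQ_Suc[OF lim_const_over_n] r_inf]) simp
    finally show ?thesis by simp
  qed
  then have "bind_pmf p K = p" by (rule pmf_eqI_le)
  with G that show thesis by blast
qed

section \<open>The embedded jump chain\<close>

text \<open>With constant exit rate \<open>L\<close> and no self-loops, both sides of global balance
  carry the factor \<open>L\<close>, and dividing by it leaves the invariance equation of
  \<open>K\<close>. Finiteness of predecessors and successors reduces the infinite sums to finite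
  ones.\<close>

lemma stationary_distribution_iff_invariant:
  assumes Q: "\<And>x y. Q x y = L * pmf (K x) y" and L: "0 < L"
    and loop: "\<And>x. pmf (K x) x = 0"
    and succ: "\<And>x. finite (set_pmf (K x))" and pred: "\<And>y. finite {x. y \<in> set_pmf (K x)}"
  shows "stationary_distribution Q \<pi> \<longleftrightarrow> bind_pmf \<pi> K = \<pi>"
proof -
  have inflow: "(\<Sum>\<^sub>\<infinity>x\<in>-{y}. pmf \<pi> x * Q x y) = L * pmf (bind_pmf \<pi> K) y" for y
  proof -
    let ?P = "{x. y \<in> set_pmf (K x)}"
    have "(\<Sum>\<^sub>\<infinity>x\<in>-{y}. pmf \<pi> x * Q x y) = (\<Sum>\<^sub>\<infinity>x\<in>?P. pmf \<pi> x * Q x y)"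
      using loop by (intro infsum_cong_neutral) (auto simp: Q set_pmf_iff)
    also have "\<dots> = (\<Sum>x\<in>?P. pmf \<pi> x * Q x y)" by (rule infsum_finite[OF pred])
    also have "\<dots> = L * (\<Sum>x\<in>?P. pmf (K x) y * pmf \<pi> x)"
      by (simp add: Q sum_distrib_left ac_simps)
    also have "(\<Sum>x\<in>?P. pmf (K x) y * pmf \<pi> x) = pmf (bind_pmf \<pi> K) y"
      unfolding pmf_bind by (rule integral_measure_pmf_real[symmetric, OF pred]) (auto simp: set_pmf_iff)
    finally show ?thesis .
  qed
  have outflow: "(\<Sum>\<^sub>\<infinity>x\<in>-{y}. Q y x) = L" for y
  proof -
    have "(\<Sum>\<^sub>\<infinity>x\<in>-{y}. Q y x) = (\<Sum>\<^sub>\<infinity>x\<in>set_pmf (K y). Q y x)"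
      using loop by (intro infsum_cong_neutral) (auto simp: Q set_pmf_iff)
    also have "\<dots> = (\<Sum>x\<in>set_pmf (K y). Q y x)" by (rule infsum_finite[OF succ])
    also have "\<dots> = L" by (simp add: Q sum_distrib_left[symmetric] sum_pmf_eq_1[OF succ])
    finally show ?thesis .
  qed
  show ?thesis
    unfolding stationary_distribution_def inflow outflow using L by (auto simp: pmf_eq_iff mult.commute)
qed

section \<open>The jump kernel of the model\<close>

lemma pmf_bind_bernoulli:
  "0 \<le> w \<Longrightarrow> w \<le> 1 \<Longrightarrow>
    pmf (bind_pmf (bernoulli_pmf w) f) y = w * pmf (f True) y + (1 - w) * pmf (f False) y"
  by (simp add: pmf_bind)

lemma BH_rate_loop: "BH_rate lH lE pH pE x x = 0"
  by (cases x) (simp add: BH_rate_def)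

lemma BH_rate_finite:
  "finite {y. BH_rate lH lE pH pE x y \<noteq> 0}" "finite {x. BH_rate lH lE pH pE x y \<noteq> 0}"
proof -
  obtain h e where x: "x = (h, e)" by force
  have "{y. BH_rate lH lE pH pE x y \<noteq> 0} \<subseteq> {(Suc h, e), (h - 1, e), (h, Suc e), (h, e - 1)}"
    by (auto simp: BH_rate_def x split: if_splits)
  then show "finite {y. BH_rate lH lE pH pE x y \<noteq> 0}" by (rule finite_subset) simp
  obtain h' e' where y: "y = (h', e')" by force
  have "{x. BH_rate lH lE pH pE x y \<noteq> 0} \<subseteq> {(Suc h', e'), (h' - 1, e'), (h', Suc e'), (h', e' - 1)}"
    by (auto simp: BH_rate_def y split: if_splits)
  then show "finite {x. BH_rate lH lE pH pE x y \<noteq> 0}" by (rule finite_subset) simp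
qed

text \<open>The kernel follows the policy: draw the type of the arriving agent, then whether some
  waiting \<open>H\<close> agent and whether some waiting \<open>E\<close> agent is a partner, the
  former taking precedence. A match with an empty class has probability 0, so the truncated
  \<open>h - 1\<close> and \<open>e - 1\<close> do no harm.\<close>

definition BH_jump :: "real \<Rightarrow> real \<Rightarrow> real \<Rightarrow> real \<Rightarrow> nat \<times> nat \<Rightarrow> (nat \<times> nat) pmf" where
  "BH_jump lH lE pH pE = (\<lambda>(h, e). do {
     arrival_H \<leftarrow> bernoulli_pmf (lH / (lH + lE));
     match_H \<leftarrow> bernoulli_pmf (if arrival_H then 1 - (1 - pH^2)^h else 1 - (1 - pE * pH)^h);
     match_E \<leftarrow> bernoulli_pmf (if arrival_H then 1 - (1 - pE * pH)^e else 1 - (1 - pE^2)^e);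
     return_pmf
       (if match_H then (h - 1, e) else if match_E then (h, e - 1)
        else if arrival_H then (Suc h, e) else (h, Suc e))
   })"

locale BH =
  fixes lH lE pH pE :: real
  assumes lH: "0 < lH" and lE: "0 < lE" and pH: "0 < pH" "pH < 1" and pE: "0 < pE" "pE \<le> 1"
begin

abbreviation r where "r \<equiv> 1 - pH^2"
abbreviation q where "q \<equiv> 1 - pE * pH"
abbreviation s where "s \<equiv> 1 - pE^2"

lemma r_bounds: "0 < r" "r < 1"
  using pH by (simp_all add: power_less_one_iff abs_square_less_1)

lemma q_bounds: "0 < q" "q < 1"
proof -
  have "pE * pH \<le> 1 * pH" using pE pH by (intro mult_right_mono) auto
  with pH show "0 < q" by linarith
  show "q < 1" using pE pH by simp
qed

lemma s_bounds: "0 \<le> s" "s < 1"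
  using pE by (simp_all add: power_le_one)

lemma power_bounds: "r ^ n \<in> {0..1}" "q ^ n \<in> {0..1}" "s ^ n \<in> {0..1}"
  using r_bounds q_bounds s_bounds by (auto intro: power_le_one)

lemma lH_frac: "lH / (lH + lE) \<in> {0..1}" "1 - lH / (lH + lE) = lE / (lH + lE)"
  using lH lE by (auto simp: field_simps)

lemma pmf_BH_jump: "BH_rate lH lE pH pE x y = (lH + lE) * pmf (BH_jump lH lE pH pE x) y"
proof -
  obtain h e where x: "x = (h, e)" by force
  obtain h' e' where y: "y = (h', e')" by force
  define c where "c = lH / (lH + lE)"
  have c: "0 \<le> c" "c \<le> 1" "(lH + lE) * c = lH" "(lH + lE) * (1 - c) = lE"
    using lH lE by (auto simp: c_def field_simps)
  have pmf: "pmf (BH_jump lH lE pH pE x) y =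
    c * ((1 - r^h) * indicator {y} (h - 1, e)
       + r^h * ((1 - q^e) * indicator {y} (h, e - 1) + q^e * indicator {y} (Suc h, e)))
    + (1 - c) * ((1 - q^h) * indicator {y} (h - 1, e)
       + q^h * ((1 - s^e) * indicator {y} (h, e - 1) + s^e * indicator {y} (h, Suc e)))"
    using power_bounds(1)[of h] power_bounds(2)[of h] power_bounds(2)[of e] power_bounds(3)[of e] c(1,2)
    unfolding x BH_jump_def c_def[symmetric] by (simp add: pmf_bind_bernoulli pmf_return)
  have "(lH + lE) * pmf (BH_jump lH lE pH pE x) y =
    ((lH + lE) * c) * ((1 - r^h) * indicator {y} (h - 1, e)
       + r^h * ((1 - q^e) * indicator {y} (h, e - 1) + q^e * indicator {y} (Suc h, e)))
    + ((lH + lE) * (1 - c)) * ((1 - q^h) * indicator {y} (h - 1, e)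
       + q^h * ((1 - s^e) * indicator {y} (h, e - 1) + s^e * indicator {y} (h, Suc e)))"
    by (simp only: pmf distrib_left mult.assoc)
  also have "\<dots> = BH_rate lH lE pH pE x y"
    unfolding x y BH_rate_def c(3,4) by (cases h; cases e) (auto simp: indicator_def)
  finally show ?thesis by simp
qed

lemma nn_integral_BH_jump:
  assumes "\<And>x. 0 \<le> f x"
  shows "(\<integral>\<^sup>+y. ennreal (f y) \<partial>BH_jump lH lE pH pE (h, e)) =
    ennreal ((lH * ((1 - r^h) * f (h - 1, e) + r^h * ((1 - q^e) * f (h, e - 1) + q^e * f (Suc h, e)))
      + lE * ((1 - q^h) * f (h - 1, e) + q^h * ((1 - s^e) * f (h, e - 1) + s^e * f (h, Suc e)))) / (lH + lE))"
proof -
  \<comment> \<open>After a match with an \<open>H\<close> agent the second draw does not affect the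
    new state; this identity merges its two branches.\<close>
  have merge: "x * a + (1 - x) * a = a" for x a :: real by (simp add: algebra_simps)
  have "(\<integral>\<^sup>+y. ennreal (f y) \<partial>BH_jump lH lE pH pE (h, e)) =
    ennreal (lH / (lH + lE) * ((1 - r^h) * (q^e * f (h - 1, e) + (1 - q^e) * f (h - 1, e))
         + r^h * ((1 - q^e) * f (h, e - 1) + q^e * f (Suc h, e)))
      + lE / (lH + lE) * ((1 - q^h) * (s^e * f (h - 1, e) + (1 - s^e) * f (h - 1, e))
         + q^h * ((1 - s^e) * f (h, e - 1) + s^e * f (h, Suc e))))"
    using power_bounds lH_frac lH lE assms unfolding BH_jump_def
    by (simp add: ennreal_plus[symmetric] ennreal_mult[symmetric] ac_simps del: ennreal_plus)
  then show ?thesis by (simp only: merge add_divide_distrib times_divide_eq_left)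
qed

lemma set_pmf_BH_jump: "y \<in> set_pmf (BH_jump lH lE pH pE x) \<longleftrightarrow> BH_rate lH lE pH pE x y \<noteq> 0"
  using lH lE by (simp add: pmf_BH_jump set_pmf_iff)

lemma stationary_iff: 
  "stationary_distribution (BH_rate lH lE pH pE) \<pi> \<longleftrightarrow> bind_pmf \<pi> (BH_jump lH lE pH pE) = \<pi>"
proof (rule stationary_distribution_iff_invariant[where L = "lH + lE"])
  show "pmf (BH_jump lH lE pH pE x) x = 0" for x
    using pmf_BH_jump[of x x] lH lE by (simp add: BH_rate_loop)
  show "finite (set_pmf (BH_jump lH lE pH pE x))" for x
    by (rule finite_subset[OF _ BH_rate_finite(1)[of lH lE pH pE x]]) (auto simp: set_pmf_BH_jump)
  show "finite {x. y \<in> set_pmf (BH_jump lH lE pH pE x)}" for y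
    unfolding set_pmf_BH_jump by (rule BH_rate_finite)
qed (use pmf_BH_jump lH lE in auto)

text \<open>First the \<open>H\<close> agents and then the \<open>E\<close> agents can leave one at
  a time, since each such transition has positive rate.\<close>

lemma reach_empty: "(x, (0, 0)) \<in> {(x, y). y \<in> set_pmf (BH_jump lH lE pH pE x)}\<^sup>*"
proof -
  let ?R = "{(x, y). y \<in> set_pmf (BH_jump lH lE pH pE x)}"
  have down: "1 - r ^ Suc n > 0" "1 - q ^ Suc n > 0" for n
    using r_bounds q_bounds by (simp_all add: power_less_one_iff del: power_Suc)
  have stepH: "((Suc h, e), (h, e)) \<in> ?R" for h e
  proof -
    have "0 < lH * (1 - r ^ Suc h) + lE * (1 - q ^ Suc h)"
      using lH lE down by (intro add_pos_pos mult_pos_pos)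
    then show ?thesis by (simp add: set_pmf_BH_jump BH_rate_def del: power_Suc)
  qed
  have stepE: "((h, Suc e), (h, e)) \<in> ?R" for h e
  proof -
    have "0 < lH * r^h * (1 - q ^ Suc e)"
      using lH r_bounds down by (intro mult_pos_pos zero_less_power)
    moreover have "0 \<le> lE * q^h * (1 - s ^ Suc e)"
      using lE power_bounds(2)[of h] power_bounds(3)[of "Suc e"] by simp
    ultimately show ?thesis by (simp add: set_pmf_BH_jump BH_rate_def del: power_Suc)
  qed
  have "((h, e), (0, e)) \<in> ?R\<^sup>*" for h e
  proof (induction h)
    case (Suc h)
    from converse_rtrancl_into_rtrancl[OF stepH this] show ?case .
  qed simp
  moreover have "((0, e), (0, 0)) \<in> ?R\<^sup>*" for e
  proof (induction e)
    case (Suc e)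
    from converse_rtrancl_into_rtrancl[OF stepE this] show ?case .
  qed simp
  ultimately show ?thesis by (cases x) (metis rtrancl_trans)
qed

end

section \<open>Lyapunov estimate and limit\<close>

text \<open>Both signs of \<open>u\<close> follow from \<open>1 + y \<le> exp y\<close>. The lower
  bound is quadratic near 0 and linear at infinity.\<close>

lemma mult_one_minus_exp_lower:
  fixes u :: real
  shows "u\<^sup>2 / (1 + \<bar>u\<bar>) \<le> u * (1 - exp (- u))"
proof (cases "0 \<le> u")
  case True
  have "exp (- u) \<le> 1 / (1 + u)"
    using exp_ge_add_one_self[of u] True by (simp add: exp_minus field_simps)
  then have "u / (1 + u) \<le> 1 - exp (- u)" using True by (simp add: field_simps)
  from mult_left_mono[OF this True] True show ?thesis by (simp add: power2_eq_square)
next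
  case False
  have "u\<^sup>2 / (1 + \<bar>u\<bar>) \<le> u\<^sup>2 / 1" by (intro divide_left_mono) auto
  also have "\<dots> = (- u) * (- u)" by (simp add: power2_eq_square)
  also have "\<dots> \<le> (- u) * (exp (- u) - 1)"
    using False exp_ge_add_one_self[of "- u"] by (intro mult_left_mono) auto
  finally show ?thesis by (simp add: algebra_simps)
qed

text \<open>Either \<bar>u\<bar> is at most \<delta>, or
  \<open>u\<^sup>2 / (1 + \<bar>u\<bar>)\<close> is at least
  \<open>\<delta> * \<bar>u\<bar> / 2\<close>. The free parameter \<delta> allows the two terms to
  be balanced later.\<close>

lemma abs_le_mult_one_minus_exp:
  fixes u \<delta> :: real
  assumes "0 < \<delta>" "\<delta> \<le> 1"
  shows "\<bar>u\<bar> \<le> \<delta> + 2 / \<delta> * (u * (1 - exp (- u)))"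
proof -
  have "\<bar>u\<bar> \<le> \<delta> + 2 / \<delta> * (u\<^sup>2 / (1 + \<bar>u\<bar>))"
  proof (cases "\<bar>u\<bar> \<le> \<delta>")
    case True
    moreover have "0 \<le> 2 / \<delta> * (u\<^sup>2 / (1 + \<bar>u\<bar>))" using assms by simp
    ultimately show ?thesis by linarith
  next
    case False
    have "\<delta> * \<bar>u\<bar> \<le> 1 * \<bar>u\<bar>" using assms by (intro mult_right_mono) auto
    then have "\<delta> * (1 + \<bar>u\<bar>) \<le> 2 * \<bar>u\<bar>" using False by (simp add: distrib_left)
    then have "\<bar>u\<bar> * (\<delta> * (1 + \<bar>u\<bar>)) \<le> \<bar>u\<bar> * (2 * \<bar>u\<bar>)" by (intro mult_left_mono) auto
    then have "\<bar>u\<bar> * (\<delta> * (1 + \<bar>u\<bar>)) \<le> 2 * u\<^sup>2" by (simp add: power2_eq_square)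
    then have "\<bar>u\<bar> \<le> 2 * u\<^sup>2 / (\<delta> * (1 + \<bar>u\<bar>))"
      using assms by (subst pos_le_divide_eq) auto
    then show ?thesis using assms by simp
  qed
  also have "\<dots> \<le> \<delta> + 2 / \<delta> * (u * (1 - exp (- u)))"
    using assms by (intro add_left_mono mult_left_mono mult_one_minus_exp_lower) auto
  finally show ?thesis .
qed

lemma one_minus_power_le:
  fixes a :: real
  assumes "0 \<le> a" "a \<le> 1"
  shows "1 - (1 - a) ^ n \<le> n * a"
  using Bernoulli_inequality[of "- a" n] assms by simp

text \<open>This is \<open>t * exp (- t) \<le> 1\<close> at \<open>t = n * a\<close>. It will bound
  \<open>e * s ^ e\<close>, the growth of the \<open>E\<close> queue through unmatched
  arrivals.\<close>

lemma mult_power_le_inverse: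
  fixes a :: real
  assumes "0 < a" "a \<le> 1"
  shows "n * (1 - a) ^ n \<le> 1 / a"
proof -
  have "(1 - a) ^ n \<le> exp (- a) ^ n"
    using assms exp_ge_add_one_self[of "- a"] by (intro power_mono) auto
  also have "\<dots> = exp (- (n * a))" by (simp add: exp_of_nat_mult[symmetric])
  finally have "(n * a) * (1 - a) ^ n \<le> (n * a) * exp (- (n * a))"
    using assms by (intro mult_left_mono) auto
  also have "\<dots> \<le> exp (n * a) * exp (- (n * a))"
  proof (rule mult_right_mono)
    show "n * a \<le> exp (n * a)" using exp_ge_add_one_self[of "n * a"] by linarith
  qed simp
  also have "\<dots> = 1" by (simp add: exp_minus_inverse)
  finally show ?thesis using assms by (simp add: field_simps)
qed

section \<open>The Lyapunov function and its drift\<close>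

text \<open>The additive constant of the drift inequality, free of \<open>p\<^sub>H\<close>. Its
  summands come from the second-order terms of the quadratic Lyapunov function, from the
  perturbation left of \<open>h0\<close>, and from \<open>E\<close> agents joining the
  queue.\<close>

definition BH_drift_bound :: "real \<Rightarrow> real \<Rightarrow> real \<Rightarrow> real" where
  "BH_drift_bound lH lE pE = (let \<epsilon> = 1 - lH / lE; x = - ln \<epsilon>; a = lH * x / \<epsilon> + 1
     in (1 + a / lE) * (lH + lE) / 2 + 2 * lH * (x / pE)^2 + 2 * a / pE^2)"

locale BH_subcritical = BH + assumes lH_less: "lH < lE"
begin

text \<open>At the equilibrium level \<open>h0\<close> an arriving \<open>E\<close> agent has no
  partner among the waiting \<open>H\<close> agents with probability \<epsilon>; then
  \<open>H\<close> agents leave at rate \<open>lE * (1 - \<epsilon>) = lH\<close>.\<close>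

definition \<epsilon> where "\<epsilon> = 1 - lH / lE"
definition x where "x = - ln \<epsilon>"
definition \<beta> where "\<beta> = - ln q"
definition h0 where "h0 = x / \<beta>"
text \<open>The perturbation costs at most \<open>lH * x / \<epsilon>\<close> times
  \<open>q ^ h * e\<close>. The extra 1 leaves a full \<open>- q ^ h * e\<close> in the
  drift.\<close>

definition a where "a = lH * x / \<epsilon> + 1"
definition V where "V = (\<lambda>(h, e). (real h - h0)^2 / 2 + a / lE * real e ^ 2 / 2)"
text \<open>The dissipation of \<open>V\<close> per jump: the restoring force in \<open>h\<close>
  plus the downward drift left over in \<open>e\<close>.\<close>

definition G where "G = (\<lambda>(h, e). (lE * \<epsilon> * ((real h - h0) * (1 - exp (- (\<beta> * (real h - h0)))))
  + q ^ h * real e) / (lH + lE))"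
abbreviation C where "C \<equiv> BH_drift_bound lH lE pE"

lemma eps: "0 < \<epsilon>" "\<epsilon> < 1" "lE * (1 - \<epsilon>) = lH"
  using lH lE lH_less by (auto simp: \<epsilon>_def)

lemma x_pos: "0 < x"
  using eps by (simp add: x_def)

lemma beta: "0 < \<beta>" "pE * pH \<le> \<beta>"
proof -
  have "ln q \<le> - (pE * pH)" using ln_le_minus_one[OF q_bounds(1)] by simp
  then show "pE * pH \<le> \<beta>" by (simp add: \<beta>_def)
  then show "0 < \<beta>" using pE pH by (meson mult_pos_pos order_less_le_trans)
qed

lemma h0: "0 < h0" "\<beta> * h0 = x" "pH * h0 \<le> x / pE"
proof -
  show "0 < h0" "\<beta> * h0 = x" using beta x_pos by (simp_all add: h0_def)
  then have "pE * pH * h0 \<le> x"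
    using mult_right_mono[OF beta(2), of h0] by simp
  then show "pH * h0 \<le> x / pE" using pE by (simp add: field_simps)
qed

text \<open>Since \<open>q ^ h = exp (- \<beta> * h)\<close> and
  \<open>\<beta> * h0 = x = - ln \<epsilon>\<close>, recentring at \<open>h0\<close> extracts the
  factor \<epsilon>.\<close>

lemma q_power: "q ^ h = \<epsilon> * exp (- (\<beta> * (real h - h0)))"
proof -
  have "q ^ h = exp (ln q) ^ h" using q_bounds by simp
  also have "\<dots> = exp (- (\<beta> * h))" by (simp add: exp_of_nat_mult[symmetric] \<beta>_def mult.commute)
  also have "- (\<beta> * h) = ln \<epsilon> + - (\<beta> * (real h - h0))"
    using h0(2) by (simp add: x_def algebra_simps)
  finally show ?thesis using eps(1) by (simp only: exp_add exp_ln)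
qed

lemma a_pos: "0 < a"
  using lH x_pos eps by (simp add: a_def add_pos_pos)

lemma C_eq: "C = (1 + a / lE) * (lH + lE) / 2 + 2 * lH * (x / pE)^2 + 2 * a / pE^2"
  by (simp add: BH_drift_bound_def Let_def a_def x_def \<epsilon>_def)

lemma C_nonneg: "0 \<le> C"
  using a_pos lH lE pE by (simp add: C_eq)

lemma V_nonneg: "0 \<le> V y"
  using a_pos lE by (auto simp: V_def split: prod.split)

lemma restoring_nonneg: "0 \<le> (t::real) * (1 - exp (- (\<beta> * t)))"
  using beta by (cases "0 \<le> t") (auto intro: mult_nonneg_nonneg mult_nonpos_nonpos simp: mult_le_0_iff)

lemma G_nonneg: "0 \<le> G y"
  using restoring_nonneg eps lE lH power_bounds(2)
  by (auto simp: G_def split: prod.split intro!: divide_nonneg_nonneg add_nonneg_nonneg mult_nonneg_nonneg)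

text \<open>Left of \<open>h0\<close> the perturbation by \<open>H\<close>--\<open>H\<close> and \<open>H\<close>--\<open>E\<close> matches pulls away from \<open>h0\<close>;
  there \<open>q ^ h \<ge> \<epsilon>\<close>, so this is absorbed by the downward drift of \<open>e\<close>.\<close>

lemma perturbation_bound:
  "- (real h - h0) * ((1 - r^h) + (1 - r^h * q^e)) \<le> 2 * (x / pE)^2 + x * (q^h * e / \<epsilon>)"
proof (cases "h0 \<le> h")
  case True
  have "r^h * q^e \<le> 1" using power_bounds(1)[of h] power_bounds(2)[of e] by (simp add: mult_le_one)
  then have "0 \<le> (1 - r^h) + (1 - r^h * q^e)" using power_bounds(1)[of h] by simp
  then have "- (real h - h0) * ((1 - r^h) + (1 - r^h * q^e)) \<le> 0"
    using True by (intro mult_nonpos_nonneg) auto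
  also have "0 \<le> 2 * (x / pE)^2 + x * (q^h * e / \<epsilon>)"
    using x_pos eps power_bounds(2)[of h] by simp
  finally show ?thesis .
next
  case False
  have "1 - r^h \<le> h * pH^2" by (rule one_minus_power_le) (use pH in \<open>auto simp: power_le_one\<close>)
  also have "\<dots> \<le> h0 * pH^2" using False by (intro mult_right_mono) auto
  finally have R: "1 - r^h \<le> h0 * pH^2" .
  have Q: "1 - q^e \<le> e * (pE * pH)" by (rule one_minus_power_le) (use q_bounds pE pH in auto)
  \<comment> \<open>Union bound: failing to join because of some \<open>H\<close> or some
    \<open>E\<close> partner costs at most the sum of the two probabilities.\<close>
  have "0 \<le> (1 - r^h) * (1 - q^e)" using power_bounds(1)[of h] power_bounds(2)[of e] by simp
  then have "1 - r^h * q^e \<le> (1 - r^h) + (1 - q^e)" by (simp add: algebra_simps)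
  with R Q have RQ: "(1 - r^h) + (1 - r^h * q^e) \<le> 2 * h0 * pH^2 + e * (pE * pH)" by linarith
  have "0 \<le> 1 - r^h * q^e" using power_bounds(1)[of h] power_bounds(2)[of e] by (simp add: mult_le_one)
  then have "- (real h - h0) * ((1 - r^h) + (1 - r^h * q^e)) \<le> h0 * (2 * h0 * pH^2 + e * (pE * pH))"
    using RQ h0(1) False power_bounds(1)[of h] by (intro mult_mono) auto
  also have "\<dots> = 2 * (pH * h0)^2 + pE * (pH * h0) * e"
    by (simp add: algebra_simps power2_eq_square)
  \<comment> \<open>The bound \<open>pH * h0 \<le> x / pE\<close> removes \<open>pH\<close>, which
    makes the estimate uniform.\<close>
  also have "\<dots> \<le> 2 * (x / pE)^2 + pE * (x / pE) * e"
    using h0 pH pE by (intro add_mono mult_left_mono mult_right_mono power_mono) auto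
  also have "\<dots> = 2 * (x / pE)^2 + x * e" using pE by simp
  also have "x * e \<le> x * (q^h * e / \<epsilon>)"
  proof -
    have "0 \<le> - (\<beta> * (real h - h0))" using False beta by (simp add: mult_le_0_iff)
    then have "1 \<le> exp (- (\<beta> * (real h - h0)))" by simp
    then have "1 * real e \<le> exp (- (\<beta> * (real h - h0))) * e" by (intro mult_right_mono) auto
    then show ?thesis using x_pos eps by (simp add: q_power)
  qed
  finally show ?thesis by simp
qed

text \<open>The expected change of the quadratic \<open>V\<close> splits into a restoring term in
  \<open>h\<close>, the perturbation bounded above, a downward drift in \<open>e\<close> and bounded
  second-order terms. An \<open>E\<close> arrival raises \<open>e\<close> only with probability at
  most \<open>s ^ e\<close>, and \<open>e * s ^ e\<close> is bounded.\<close>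

lemma drift_real:
  "lH * ((1 - r^h) * V (h - 1, e) + r^h * ((1 - q^e) * V (h, e - 1) + q^e * V (Suc h, e)))
   + lE * ((1 - q^h) * V (h - 1, e) + q^h * ((1 - s^e) * V (h, e - 1) + s^e * V (h, Suc e)))
   \<le> (lH + lE) * V (h, e) + C - (lH + lE) * G (h, e)" (is "?L \<le> _")
proof -
  define t where "t = real h - h0"
  define \<kappa> where "\<kappa> = a / lE"
  have \<kappa>: "0 < \<kappa>" "\<kappa> * lE = a" using a_pos lE by (simp_all add: \<kappa>_def)
  define v where "v = V (h, e)"
  define R where "R = r^h"
  define P where "P = q^h"
  define Q where "Q = q^e"
  define S where "S = s^e"
  have bounds: "0 \<le> R" "R \<le> 1" "0 \<le> P" "P \<le> 1" "0 \<le> Q" "Q \<le> 1" "0 \<le> S" "S \<le> 1"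
    using power_bounds by (auto simp: R_def P_def Q_def S_def)
  have V_eq: "V (i, j) = (real i - h0)^2 / 2 + \<kappa> * real j ^ 2 / 2" for i j
    by (simp add: V_def \<kappa>_def)
  have V_h: "V (i, e) = V (Suc i, e) - (real (Suc i) - h0) + 1/2" for i
    unfolding V_eq by (simp add: power2_eq_square field_simps)
  have V_e: "V (h, j) = V (h, Suc j) - \<kappa> * real (Suc j) + \<kappa> / 2" for j
    unfolding V_eq by (simp add: power2_eq_square field_simps)
  \<comment> \<open>At \<open>h = 0\<close> the factors \<open>1 - R\<close> and
    \<open>1 - P\<close> vanish, so the truncated \<open>h - 1\<close> is harmless; likewise for
    \<open>e\<close> below.\<close>
  have down_h: "(1 - R) * V (h - 1, e) = (1 - R) * (v - t + 1/2)"
    "(1 - P) * V (h - 1, e) = (1 - P) * (v - t + 1/2)"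
    using V_h[of "h - 1"] by (cases h; simp add: R_def P_def v_def t_def del: power_Suc of_nat_Suc)+
  have down_e: "(1 - Q) * V (h, e - 1) = (1 - Q) * (v - \<kappa> * e + \<kappa> / 2)"
    "(1 - S) * V (h, e - 1) = (1 - S) * (v - \<kappa> * e + \<kappa> / 2)"
    using V_e[of "e - 1"] by (cases e; simp add: Q_def S_def v_def del: power_Suc of_nat_Suc)+
  have up: "V (Suc h, e) = v + t + 1/2" "V (h, Suc e) = v + \<kappa> * e + \<kappa> / 2"
    using V_h[of h] V_e[of e] by (simp_all add: v_def t_def distrib_left)
  have pert: "- t * ((1 - R) + (1 - R * Q)) \<le> 2 * (x / pE)^2 + x * (P * e / \<epsilon>)"
    using perturbation_bound[of h e] by (simp add: t_def R_def Q_def P_def)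
  have eS: "e * S \<le> 1 / pE^2"
    unfolding S_def by (rule mult_power_le_inverse) (use pE in \<open>auto simp: power_le_one\<close>)
  have "?L = lH * ((1 - R) * (v - t + 1/2) + R * ((1 - Q) * (v - \<kappa> * e + \<kappa> / 2) + Q * (v + t + 1/2)))
     + lE * ((1 - P) * (v - t + 1/2) + P * ((1 - S) * (v - \<kappa> * e + \<kappa> / 2) + S * (v + \<kappa> * e + \<kappa> / 2)))"
    by (simp only: R_def[symmetric] P_def[symmetric] Q_def[symmetric] S_def[symmetric] down_h down_e up)
  also have "\<dots> = (lH + lE) * v
     + lH * (- t * ((1 - R) + (1 - R * Q))) + t * (lH - lE * (1 - P))
     + (lH * ((1 - R) + R * Q) + lE * (1 - P)) / 2
     + \<kappa> * (lH * (R * (1 - Q)) + lE * P) / 2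
     - \<kappa> * lH * (e * (R * (1 - Q))) - \<kappa> * lE * (P * e) + 2 * (\<kappa> * lE) * (P * (e * S))"
    by (simp add: field_simps)
  \<comment> \<open>Each error term is bounded separately; the 0 replaces the favourable departures
    of \<open>E\<close> agents matched to arriving \<open>H\<close> agents.\<close>
  also have "\<dots> \<le> (lH + lE) * v
     + lH * (2 * (x / pE)^2 + x * (P * e / \<epsilon>)) + t * (lH - lE * (1 - P))
     + (lH * 1 + lE * 1) / 2
     + \<kappa> * (lH * 1 + lE * 1) / 2
     - 0 - \<kappa> * lE * (P * e) + 2 * (\<kappa> * lE) * (1 * (1 / pE^2))"
  proof (intro add_mono diff_mono order_refl divide_right_mono mult_left_mono mult_mono pert eS)
    have "R * Q \<le> R * 1" using bounds by (intro mult_left_mono) auto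
    then show "(1 - R) + R * Q \<le> 1" by simp
    show "R * (1 - Q) \<le> 1" using bounds by (intro mult_le_one) auto
    show "0 \<le> \<kappa> * lH * (e * (R * (1 - Q)))" using bounds \<kappa> lH by simp
  qed (use bounds \<kappa> a_pos lH lE pE in auto)
  \<comment> \<open>The choice of \<open>a\<close> gives \<open>a - lH * x / \<epsilon> = 1\<close>,
    so exactly \<open>- P * e\<close> remains.\<close>
  also have "\<dots> = (lH + lE) * v + C + t * (lH - lE * (1 - P)) - P * e"
    unfolding C_eq \<kappa>(2) \<kappa>_def[symmetric] by (simp add: a_def field_simps)
  also have "t * (lH - lE * (1 - P)) = - (lE * \<epsilon> * (t * (1 - exp (- (\<beta> * t)))))"
  proof -
    have "P = \<epsilon> * exp (- (\<beta> * t))" by (simp add: P_def t_def q_power)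
    moreover have "lH - lE * (1 - P) = - (lE * (\<epsilon> - P))" using eps(3) by (simp add: algebra_simps)
    ultimately have *: "lH - lE * (1 - P) = - (lE * (\<epsilon> - \<epsilon> * exp (- (\<beta> * t))))" by (simp only:)
    show ?thesis unfolding * by (simp add: algebra_simps)
  qed
  also have "(lH + lE) * v + C + - (lE * \<epsilon> * (t * (1 - exp (- (\<beta> * t))))) - P * e
      = (lH + lE) * V (h, e) + C - (lH + lE) * G (h, e)"
    using lH lE by (simp add: G_def v_def t_def P_def)
  finally show ?thesis .
qed

lemma drift:
  "(\<integral>\<^sup>+z. ennreal (V z) \<partial>BH_jump lH lE pH pE y) + ennreal (G y) \<le> ennreal (V y) + ennreal (C / (lH + lE))"
proof -
  obtain h e where y: "y = (h, e)" by force
  let ?L = "lH * ((1 - r^h) * V (h - 1, e) + r^h * ((1 - q^e) * V (h, e - 1) + q^e * V (Suc h, e)))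
     + lE * ((1 - q^h) * V (h - 1, e) + q^h * ((1 - s^e) * V (h, e - 1) + s^e * V (h, Suc e)))"
  have "0 \<le> ?L" using lH lE power_bounds V_nonneg
    by (intro add_nonneg_nonneg mult_nonneg_nonneg) auto
  moreover have "?L / (lH + lE) + G (h, e) \<le> V (h, e) + C / (lH + lE)"
  proof -
    have "l / w + g \<le> v + c / w" if "l \<le> w * v + c - w * g" "0 < w" for l w g v c :: real
      using divide_right_mono[OF that(1), of w] that(2) by (simp add: add_divide_distrib diff_divide_distrib)
    from this[OF drift_real] show ?thesis using lH lE by simp
  qed
  ultimately show ?thesis
    using V_nonneg[of y] G_nonneg[of y] C_nonneg lH lE
    by (simp only: y nn_integral_BH_jump[OF V_nonneg])
       (simp add: ennreal_plus[symmetric] ennreal_leI del: ennreal_plus)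
qed

lemma G_lower: "lE * \<epsilon> * ((real h - h0) * (1 - exp (- (\<beta> * (real h - h0))))) \<le> (lH + lE) * G (h, e)"
  using power_bounds(2)[of h] lH lE by (simp add: G_def)

text \<open>The restoring term grows linearly to the right of \<open>h0\<close> and so bounds
  \<open>h\<close> by some \<open>N\<close>. Then \<open>q ^ h \<ge> q ^ N\<close> turns the second
  term of \<open>G\<close> into a bound on \<open>e\<close>. These bounds may depend on
  \<open>pH\<close>, as only finiteness matters.\<close>

lemma finite_sublevel: "finite {y. ennreal (G y) \<le> of_nat m}"
proof -
  define b where "b = (lH + lE) * m"
  define N where "N = nat \<lceil>h0 + 1 / \<beta> + 2 * b / (lE * \<epsilon>)\<rceil>"
  define M where "M = nat \<lceil>b / q ^ N\<rceil>"
  have "h \<le> N \<and> e \<le> M" if "ennreal (G (h, e)) \<le> of_nat m" for h e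
  proof -
    define t where "t = real h - h0"
    have "ennreal (G (h, e)) \<le> ennreal m" using that by (simp add: ennreal_of_nat_eq_real_of_nat)
    then have "G (h, e) \<le> m" by simp
    then have Gb: "(lH + lE) * G (h, e) \<le> b" using lH lE by (simp add: b_def)
    then have "lE * \<epsilon> * (t * (1 - exp (- (\<beta> * t)))) \<le> b"
      using G_lower[of h e] by (simp add: t_def)
    then have tb: "t * (1 - exp (- (\<beta> * t))) \<le> b / (lE * \<epsilon>)"
      using lE eps by (simp add: field_simps)
    have "\<beta> * t \<le> 1 + 2 * (\<beta> * t * (1 - exp (- (\<beta> * t))))"
      using abs_le_mult_one_minus_exp[of 1 "\<beta> * t"] by simp
    then have "\<beta> * t \<le> \<beta> * (1 / \<beta> + 2 * (t * (1 - exp (- (\<beta> * t)))))"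
      using beta by (simp add: algebra_simps)
    then have "t \<le> 1 / \<beta> + 2 * (t * (1 - exp (- (\<beta> * t))))"
      using beta by (simp only: mult_le_cancel_left_pos)
    with tb have "real h \<le> h0 + 1 / \<beta> + 2 * (b / (lE * \<epsilon>))" by (simp add: t_def)
    also have "\<dots> \<le> real N" unfolding N_def by (simp add: real_nat_ceiling_ge)
    finally have hN: "h \<le> N" by simp
    have "q ^ N * e \<le> q ^ h * e"
      using hN q_bounds by (intro mult_right_mono power_decreasing) auto
    also have "\<dots> \<le> (lH + lE) * G (h, e)"
      using restoring_nonneg[of "real h - h0"] lH lE eps by (simp add: G_def)
    also note Gb
    finally have "real e \<le> b / q ^ N" using q_bounds by (simp add: field_simps)
    also have "\<dots> \<le> real M" unfolding M_def by (rule real_nat_ceiling_ge)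
    finally show ?thesis using hN by simp
  qed
  then have "{y. ennreal (G y) \<le> of_nat m} \<subseteq> {..N} \<times> {..M}" by auto
  then show ?thesis by (rule finite_subset) simp
qed

section \<open>Concentration of the stationary queue length\<close>

text \<open>Existence provides an invariant distribution with this moment bound; uniqueness
  identifies it with the one selected by \<open>THE\<close>.\<close>

lemma BH_stationary_moment: "(\<integral>\<^sup>+y. ennreal (G y) \<partial>BH_stationary lH lE pH pE) \<le> ennreal (C / (lH + lE))"
proof -
  obtain p where p: "bind_pmf p (BH_jump lH lE pH pE) = p"
    and G: "(\<integral>\<^sup>+y. ennreal (G y) \<partial>p) \<le> ennreal (C / (lH + lE))"
    by (rule pmf_invariant_exists[OF drift _ _ finite_sublevel, of "(0, 0)"]) auto
  have "BH_stationary lH lE pH pE = p"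
    unfolding BH_stationary_def stationary_iff
    by (rule the_equality) (use p pmf_invariant_unique[OF _ _ reach_empty] in blast)+
  with G show ?thesis by simp
qed

lemma BH_mean_estimate:
  assumes "\<beta> \<le> 1"
  obtains m where "(\<integral>\<^sup>+(h, e). of_nat h \<partial>BH_stationary lH lE pH pE) = ennreal m" "0 \<le> m"
    "\<bar>\<beta> * m - x\<bar> \<le> sqrt \<beta> * (1 + 2 * C / (lE * \<epsilon>))"
proof -
  let ?\<pi> = "BH_stationary lH lE pH pE"
  define D where "D = sqrt \<beta> * (1 + 2 * C / (lE * \<epsilon>))"
  have D: "0 \<le> D" using beta C_nonneg lE eps by (simp add: D_def)
  have sb: "0 < sqrt \<beta>" "sqrt \<beta> \<le> 1" "\<beta> = sqrt \<beta> * sqrt \<beta>" using beta assms by auto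
  define c where "c = 2 / sqrt \<beta> * \<beta> * ((lH + lE) / (lE * \<epsilon>))"
  have c: "0 \<le> c" using beta lH lE eps by (simp add: c_def)
  have point: "\<bar>\<beta> * real h - x\<bar> \<le> sqrt \<beta> + c * G (h, e)" for h e
  proof -
    let ?t = "real h - h0"
    have "\<bar>\<beta> * real h - x\<bar> = \<bar>\<beta> * ?t\<bar>" using h0(2) by (simp add: algebra_simps)
    \<comment> \<open>The choice \<open>\<delta> = sqrt \<beta>\<close> balances the two terms: the
      factor \<open>2 / \<delta> * \<beta>\<close> is then also of order
      \<open>sqrt \<beta>\<close>.\<close>
    also have "\<dots> \<le> sqrt \<beta> + 2 / sqrt \<beta> * (\<beta> * ?t * (1 - exp (- (\<beta> * ?t))))"
      by (rule abs_le_mult_one_minus_exp[OF sb(1,2)])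
    also have "\<dots> = sqrt \<beta> + 2 / sqrt \<beta> * \<beta> * (?t * (1 - exp (- (\<beta> * ?t))))" by simp
    also have "\<dots> \<le> sqrt \<beta> + 2 / sqrt \<beta> * \<beta> * ((lH + lE) / (lE * \<epsilon>) * G (h, e))"
      using G_lower[of h e] beta lE eps by (intro add_left_mono mult_left_mono) (auto simp: field_simps)
    finally show ?thesis by (simp add: c_def)
  qed
  have "(\<integral>\<^sup>+(h, e). ennreal \<bar>\<beta> * real h - x\<bar> \<partial>?\<pi>) \<le> (\<integral>\<^sup>+y. ennreal (sqrt \<beta>) + ennreal c * ennreal (G y) \<partial>?\<pi>)"
    using point sb c G_nonneg
    by (intro nn_integral_mono)
       (auto simp: ennreal_plus[symmetric] ennreal_mult[symmetric] intro!: ennreal_leI simp del: ennreal_plus)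
  also have "\<dots> = ennreal (sqrt \<beta>) + ennreal c * (\<integral>\<^sup>+y. ennreal (G y) \<partial>?\<pi>)"
    by (simp add: nn_integral_add nn_integral_cmult)
  also have "\<dots> \<le> ennreal (sqrt \<beta>) + ennreal c * ennreal (C / (lH + lE))"
    by (intro add_left_mono mult_left_mono BH_stationary_moment) auto
  also have "\<dots> = ennreal (sqrt \<beta> + c * (C / (lH + lE)))"
    using sb c C_nonneg lH lE by (simp add: ennreal_plus[symmetric] ennreal_mult[symmetric] del: ennreal_plus)
  also have "sqrt \<beta> + c * (C / (lH + lE)) = D"
  proof -
    have "2 / sqrt \<beta> * \<beta> = 2 * sqrt \<beta>" using sb by (simp add: field_simps)
    then have "c = 2 * sqrt \<beta> * ((lH + lE) / (lE * \<epsilon>))" by (simp only: c_def)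
    then have "c * (C / (lH + lE)) = 2 * sqrt \<beta> * ((lH + lE) / (lE * \<epsilon>) * (C / (lH + lE)))" by simp
    also have "(lH + lE) / (lE * \<epsilon>) * (C / (lH + lE)) = C / (lE * \<epsilon>)" using lH lE by simp
    finally show ?thesis by (simp add: D_def distrib_left)
  qed
  finally have dev: "(\<integral>\<^sup>+(h, e). ennreal \<bar>\<beta> * real h - x\<bar> \<partial>?\<pi>) \<le> ennreal D" .
  \<comment> \<open>The finite mean deviation makes \<open>h\<close> integrable, so the
    extended-valued mean is a real number \<open>m\<close>.\<close>
  have abs: "integrable ?\<pi> (\<lambda>(h, e). \<beta> * real h - x)"
    by (rule integrableI_bounded) (use dev in \<open>auto simp: case_prod_unfold intro: le_less_trans\<close>)
  then have "integrable ?\<pi> (\<lambda>y. ((\<lambda>(h, e). \<beta> * real h - x) y + x) / \<beta>)"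
    by (intro integrable_divide integrable_add) auto
  then have int: "integrable ?\<pi> (\<lambda>y. real (fst y))" using beta by (simp add: case_prod_unfold)
  define m where "m = (\<integral>y. real (fst y) \<partial>?\<pi>)"
  have "(\<integral>\<^sup>+(h, e). of_nat h \<partial>?\<pi>) = (\<integral>\<^sup>+y. ennreal (real (fst y)) \<partial>?\<pi>)"
    by (simp add: case_prod_unfold ennreal_of_nat_eq_real_of_nat)
  also have "\<dots> = ennreal m" unfolding m_def by (rule nn_integral_eq_integral[OF int]) simp
  finally have mean: "(\<integral>\<^sup>+(h, e). of_nat h \<partial>?\<pi>) = ennreal m" .
  have "\<beta> * m - x = (\<integral>y. \<beta> * real (fst y) - x \<partial>?\<pi>)" using int by (simp add: m_def)
  then have "ennreal \<bar>\<beta> * m - x\<bar> \<le> (\<integral>\<^sup>+y. norm (\<beta> * real (fst y) - x) \<partial>?\<pi>)"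
    using integral_norm_bound_ennreal[of ?\<pi> "\<lambda>y. \<beta> * real (fst y) - x"] abs by (simp add: case_prod_unfold)
  also have "\<dots> \<le> ennreal D" using dev by (simp add: case_prod_unfold)
  finally have "\<bar>\<beta> * m - x\<bar> \<le> D" using D by simp
  then show thesis using that[OF mean] by (simp add: m_def D_def)
qed

end

section \<open>The limit of vanishing \<open>p\<^sub>H\<close>\<close>

text \<open>The point is the order of quantifiers: \<open>K\<close> is fixed before
  \<open>pH\<close>, which is possible because \<open>BH_drift_bound\<close> does not involve
  \<open>pH\<close>.\<close>

lemma BH_wait_estimate:
  assumes lH: "0 < lH" "lH < lE" and pE: "0 < pE" "pE \<le> 1"
  obtains K where "\<And>pH. 0 < pH \<Longrightarrow> pH < 1 \<Longrightarrow> - ln (1 - pE * pH) \<le> 1 \<Longrightarrow>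
    \<exists>m. BH_wait_H lH lE pH pE = ennreal (m / lH) \<and> 0 \<le> m \<and>
      \<bar>- ln (1 - pE * pH) * m - (- ln (1 - lH / lE))\<bar> \<le> sqrt (- ln (1 - pE * pH)) * K"
proof (rule that)
  fix pH :: real
  assume pH: "0 < pH" "pH < 1" and small: "- ln (1 - pE * pH) \<le> 1"
  interpret BH_subcritical lH lE pH pE by unfold_locales (use assms pH in auto)
  have "\<beta> \<le> 1" using small by (simp add: \<beta>_def)
  then obtain m where m: "(\<integral>\<^sup>+(h, e). of_nat h \<partial>BH_stationary lH lE pH pE) = ennreal m" "0 \<le> m"
    "\<bar>\<beta> * m - x\<bar> \<le> sqrt \<beta> * (1 + 2 * C / (lE * \<epsilon>))"
    by (rule BH_mean_estimate)
  have "BH_wait_H lH lE pH pE = ennreal (m / lH)"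
    using m lH by (simp add: BH_wait_H_def divide_ennreal)
  with m show "\<exists>m. BH_wait_H lH lE pH pE = ennreal (m / lH) \<and> 0 \<le> m \<and>
      \<bar>- ln (1 - pE * pH) * m - (- ln (1 - lH / lE))\<bar>
        \<le> sqrt (- ln (1 - pE * pH)) * (1 + 2 * BH_drift_bound lH lE pE / (lE * (1 - lH / lE)))"
    unfolding \<beta>_def x_def \<epsilon>_def by blast
qed

text \<open>Write \<open>pH * m / lH\<close> as \<open>(pH / b) * (b * m) / lH\<close> with
  \<open>b = - ln (1 - pE * pH)\<close>. The first factor tends to \<open>1 / pE\<close>, and
  \<open>b * m\<close> tends to \<open>x\<close> by the \<open>sqrt b\<close> estimate.\<close>

lemma BH_wait_limit:
  assumes lH: "0 < lH" "lH < lE" and pE: "0 < pE" "pE \<le> 1"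
  shows "((\<lambda>pH. ennreal pH * BH_wait_H lH lE pH pE) \<longlongrightarrow> ennreal (- ln (1 - lH / lE) / (pE * lH))) (at_right 0)"
proof -
  define b where "b pH = - ln (1 - pE * pH)" for pH
  define x where "x = - ln (1 - lH / lE)"
  obtain K where K: "\<And>pH. 0 < pH \<Longrightarrow> pH < 1 \<Longrightarrow> b pH \<le> 1 \<Longrightarrow>
    \<exists>m. BH_wait_H lH lE pH pE = ennreal (m / lH) \<and> 0 \<le> m \<and> \<bar>b pH * m - x\<bar> \<le> sqrt (b pH) * K"
    using BH_wait_estimate[OF assms] unfolding b_def x_def by metis
  then obtain m where m: "\<And>pH. 0 < pH \<Longrightarrow> pH < 1 \<Longrightarrow> b pH \<le> 1 \<Longrightarrow>
    BH_wait_H lH lE pH pE = ennreal (m pH / lH) \<and> 0 \<le> m pH \<and> \<bar>b pH * m pH - x\<bar> \<le> sqrt (b pH) * K"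
    by metis
  have b_deriv: "(b has_real_derivative pE) (at 0)"
    unfolding b_def by (auto intro!: derivative_eq_intros)
  have b_0: "b 0 = 0" by (simp add: b_def)
  have b_lim: "(b \<longlongrightarrow> 0) (at_right 0)"
    using DERIV_isCont[OF b_deriv] b_0 by (simp add: isCont_def filterlim_at_split)
  \<comment> \<open>As \<open>b 0 = 0\<close>, this is the difference quotient of \<open>b\<close>
    at 0.\<close>
  have "((\<lambda>pH. b pH / pH) \<longlongrightarrow> pE) (at_right 0)"
    using b_deriv b_0 by (simp add: has_field_derivative_iff filterlim_at_split)
  then have ratio: "((\<lambda>pH. inverse (b pH / pH)) \<longlongrightarrow> inverse pE) (at_right 0)"
    using pE by (intro tendsto_inverse) auto
  have "\<forall>\<^sub>F pH in at_right 0. b pH < 1" by (rule order_tendstoD[OF b_lim]) simp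
  moreover have "\<forall>\<^sub>F pH in at_right 0. (0::real) < pH \<and> pH < 1"
    by (auto simp: eventually_at_right[of 0 1] intro: exI[of _ 1])
  ultimately have ev: "\<forall>\<^sub>F pH in at_right 0. 0 < pH \<and> pH < 1 \<and> b pH \<le> 1"
    by eventually_elim auto
  have "((\<lambda>pH. b pH * m pH - x) \<longlongrightarrow> 0) (at_right 0)"
  proof (rule Lim_null_comparison)
    show "\<forall>\<^sub>F pH in at_right 0. norm (b pH * m pH - x) \<le> sqrt (b pH) * K"
      using ev by eventually_elim (use m in auto)
    show "((\<lambda>pH. sqrt (b pH) * K) \<longlongrightarrow> 0) (at_right 0)"
      using tendsto_mult_right[OF tendsto_real_sqrt[OF b_lim], of K] by simp
  qed
  from tendsto_add[OF this tendsto_const[of x]]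
  have bm: "((\<lambda>pH. b pH * m pH) \<longlongrightarrow> x) (at_right 0)" by simp
  have "((\<lambda>pH. inverse (b pH / pH) * (b pH * m pH) / lH) \<longlongrightarrow> inverse pE * x / lH) (at_right 0)"
    by (intro tendsto_divide tendsto_mult ratio bm tendsto_const) (use lH in auto)
  then have lim: "((\<lambda>pH. ennreal (inverse (b pH / pH) * (b pH * m pH) / lH)) \<longlongrightarrow> ennreal (x / (pE * lH))) (at_right 0)"
    by (intro tendsto_ennrealI) (simp add: divide_simps mult.commute)
  have "\<forall>\<^sub>F pH in at_right 0. ennreal (inverse (b pH / pH) * (b pH * m pH) / lH) = ennreal pH * BH_wait_H lH lE pH pE"
    using ev
  proof eventually_elim
    case (elim pH)
    have "pE * pH \<le> 1 * pH" using pE elim by (intro mult_right_mono) auto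
    then have "pE * pH < 1" using elim by linarith
    moreover have "0 < pE * pH" using pE elim by simp
    ultimately have "0 < b pH" by (simp add: b_def)
    then have cancel: "inverse (b pH / pH) * (b pH * m pH) / lH = pH * (m pH / lH)" by simp
    have wait: "BH_wait_H lH lE pH pE = ennreal (m pH / lH)" and "0 \<le> m pH" using m elim by auto
    then have "ennreal (pH * (m pH / lH)) = ennreal pH * ennreal (m pH / lH)"
      using elim lH by (intro ennreal_mult) auto
    then show ?case by (simp only: cancel wait)
  qed
  from tendsto_cong[OF this] lim show ?thesis by (simp add: x_def)
qed

section \<open>Monotonicity of the limit\<close>

text \<open>The numerator of the derivative is positive by the strict inequality
  \<open>ln y < y - 1\<close> at \<open>y = 1 / (1 - z)\<close>, which differs from 1.\<close>

lemma strict_mono_neg_ln_over: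
  "strict_mono_on {0<..<1} (\<lambda>u::real. - ln (1 - u) / u)"
proof (rule strict_mono_onI)
  fix u v :: real
  assume uv: "u \<in> {0<..<1}" "v \<in> {0<..<1}" "u < v"
  show "- ln (1 - u) / u < - ln (1 - v) / v"
  proof (rule DERIV_pos_imp_increasing[OF uv(3)])
    fix z assume z: "u \<le> z" "z \<le> v"
    then have z01: "0 < z" "z < 1" using uv by auto
    have "((\<lambda>u. - ln (1 - u) / u) has_real_derivative (z / (1 - z) + ln (1 - z)) / z^2) (at z)"
      using z01 by (auto intro!: derivative_eq_intros simp: power2_eq_square add_divide_distrib diff_divide_distrib)
    moreover have "0 < (z / (1 - z) + ln (1 - z)) / z^2"
    proof -
      have "ln (inverse (1 - z)) < inverse (1 - z) - 1"
        using ln_le_minus_one[of "inverse (1 - z)"] ln_eq_minus_one[of "inverse (1 - z)"] z01 by fastforce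
      also have "inverse (1 - z) - 1 = z / (1 - z)" using z01 by (simp add: field_simps)
      finally show ?thesis using z01 by (simp add: ln_inverse)
    qed
    ultimately show "\<exists>y. ((\<lambda>u. - ln (1 - u) / u) has_real_derivative y) (at z) \<and> 0 < y" by blast
  qed
qed

text \<open>Since \<open>ennreal\<close> sends negative reals to 0, nonnegativity of
  \<open>w\<close> is asserted too; it ensures that \<open>ennreal (w lam\<^sub>H)\<close> really
  encodes \<open>w lam\<^sub>H\<close>, a finite limit.\<close>

theorem corollary1:
  fixes lam\<^sub>E p\<^sub>E :: real
  assumes "0 < lam\<^sub>E" and "0 < p\<^sub>E" and "p\<^sub>E \<le> 1"
  shows "\<exists>w :: real \<Rightarrow> real.
    (\<forall>lam\<^sub>H \<in> {0<..<lam\<^sub>E}. 0 \<le> w lam\<^sub>H \<and>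
       ((\<lambda>p\<^sub>H. ennreal p\<^sub>H * BH_wait_H lam\<^sub>H lam\<^sub>E p\<^sub>H p\<^sub>E) \<longlongrightarrow> ennreal (w lam\<^sub>H)) (at_right 0)) \<and>
    strict_mono_on {0<..<lam\<^sub>E} w"
proof (intro exI conjI ballI)
  let ?w = "\<lambda>l. - ln (1 - l / lam\<^sub>E) / (p\<^sub>E * l)"
  fix l assume l: "l \<in> {0<..<lam\<^sub>E}"
  then have "0 < 1 - l / lam\<^sub>E" "1 - l / lam\<^sub>E < 1" by auto
  then have "ln (1 - l / lam\<^sub>E) < 0" by (simp only: ln_less_zero)
  with l assms show "0 \<le> ?w l" by (simp add: divide_nonpos_pos)
  show "((\<lambda>p\<^sub>H. ennreal p\<^sub>H * BH_wait_H l lam\<^sub>E p\<^sub>H p\<^sub>E) \<longlongrightarrow> ennreal (?w l)) (at_right 0)"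
    using l assms by (intro BH_wait_limit) auto
next
  let ?w = "\<lambda>l. - ln (1 - l / lam\<^sub>E) / (p\<^sub>E * l)"
  show "strict_mono_on {0<..<lam\<^sub>E} ?w"
  proof (rule strict_mono_onI)
    fix k l assume kl: "k \<in> {0<..<lam\<^sub>E}" "l \<in> {0<..<lam\<^sub>E}" "k < l"
    then have "- ln (1 - k / lam\<^sub>E) / (k / lam\<^sub>E) < - ln (1 - l / lam\<^sub>E) / (l / lam\<^sub>E)"
      using assms by (intro strict_mono_onD[OF strict_mono_neg_ln_over]) (auto simp: divide_strict_right_mono)
    \<comment> \<open>Up to the positive constant \<open>1 / (p\<^sub>E * lam\<^sub>E)\<close> the
      limit depends on the arrival rate only through the ratio
      \<open>i / lam\<^sub>E\<close>.\<close>
    moreover have "?w i = - ln (1 - i / lam\<^sub>E) / (i / lam\<^sub>E) / (p\<^sub>E * lam\<^sub>E)" for i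
      using assms by simp
    ultimately show "?w k < ?w l"
      using assms by (simp only: divide_strict_right_mono mult_pos_pos)
  qed
qed

end
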